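(* Let $m\ge1$ be an integer and let $C=a\,C_a\oplus b\,C_b$ be an $H_{32}$-code of length $n=2m$, with binary component $C_a\subseteq\mathbb{F}_2^{n}$ and ternary component $C_b\subseteq\mathbb{F}_3^{n}$. Then $C$ is symplectic nice if and only if $C_a=\{\mathbf{0}\}$.
   Context: Ring: $H_{32}=\langle a,b\mid 2a=0,\ 3b=0,\ a^2=0,\ b^2=b,\ ab=ba=0\rangle$ is the commutative non-unital ring of order six with elements $0,a,b,a+b,2b,a+2b$. For $\mathbf{x}\in\mathbb{F}_2^n$, $a\mathbf{x}$ is the vector obtained coordinatewise from $a\cdot0=0$, $a\cdot1=a$; for $\mathbf{y}\in\mathbb{F}_3^n$, $b\mathbf{y}$ is obtained coordinatewise from $b\cdot0=0$, $b\cdot1=b$, $b\cdot2=2b$. Every vector of $H_{32}^n$ is uniquely $a\mathbf{x}+b\mathbf{y}$ with $\mathbf{x}\in\mathbb{F}_2^n$, $\mathbf{y}\in\mathbb{F}_3^n$. Codes: an $H_{32}$-code of length $n$ is an $H_{32}$-submodule $C\subseteq H_{32}^n$ (an additive subgroup closed under multiplication by elements of $H_{32}$). It decomposes as $C=aC_a\oplus bC_b=\{a\mathbf{u}+b\mathbf{v}: \mathbf{u}\in C_a,\mathbf{v}\in C_b\}$ with $C_a=\{\mathbf{u}\in\mathbb{F}_2^n: a\mathbf{u}\in C\}$ and $C_b=\{\mathbf{v}\in\mathbb{F}_3^n: b\mathbf{v}\in C\}$, which are linear codes over $\mathbb{F}_2$ and $\mathbb{F}_3$ respectively. Symplectic forms: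 for $\mathbf{x}=(\mathbf{x}_1\mid\mathbf{x}_2),\mathbf{y}=(\mathbf{y}_1\mid\mathbf{y}_2)\in\mathbb{F}_3^{2m}$ with $\mathbf{x}_i,\mathbf{y}_i\in\mathbb{F}_3^m$, set $\langle\mathbf{x},\mathbf{y}\rangle_s^{(\mathbb{F}_3)}=\mathbf{x}_1\cdot\mathbf{y}_2-\mathbf{x}_2\cdot\mathbf{y}_1$, where $\cdot$ is the usual dot product. For $\mathbf{c}=a\mathbf{x}+b\mathbf{y}$, $\mathbf{c}'=a\mathbf{x}'+b\mathbf{y}'$ in $H_{32}^{2m}$ (with $\mathbf{x},\mathbf{x}'\in\mathbb{F}_2^{2m}$, $\mathbf{y},\mathbf{y}'\in\mathbb{F}_3^{2m}$), set $\langle\mathbf{c},\mathbf{c}'\rangle_S=b\langle\mathbf{y},\mathbf{y}'\rangle_s^{(\mathbb{F}_3)}$ (the binary part contributes $0$ because $a^2=0$). The symplectic dual of an $H_{32}$-code $C$ of length $2m$ is $C^{\perp_S}=\{\mathbf{y}\in H_{32}^{2m}:\langle\mathbf{y},\mathbf{c}\rangle_S=0\text{ for all }\mathbf{c}\in C\}$. $C$ is symplectic nice if $|C|\,|C^{\perp_S}|=36^m$. *)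

theory Defs
  imports "HOL-Analysis.Analysis"
begin

text \<open>
  The numeral types \<open>2\<close> and \<open>3\<close> of \<^theory>\<open>HOL-Library.Numeral_Type\<close> (integers modulo 2 and
  modulo 3) serve as the prime fields with two and three elements. The constructor \<open>H32 x y\<close>
  stands for the ring element \<open>a x + b y\<close>.
\<close>

datatype h32 = H32 (bin: "2") (ter: "3")

instantiation h32 :: comm_ring
begin

definition zero_h32 :: h32 where "0 = H32 0 0"
definition plus_h32 :: "h32 \<Rightarrow> h32 \<Rightarrow> h32"
  where "r + s = H32 (bin r + bin s) (ter r + ter s)"
definition uminus_h32 :: "h32 \<Rightarrow> h32"
  where "- r = H32 (- bin r) (- ter r)"
definition minus_h32 :: "h32 \<Rightarrow> h32 \<Rightarrow> h32"
  where "r - s = H32 (bin r - bin s) (ter r - ter s)"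

text \<open>\<open>(a x + b y) (a x' + b y') = b y y'\<close>, since \<open>a\<^sup>2 = ab = ba = 0\<close> and \<open>b\<^sup>2 = b\<close>.\<close>

definition times_h32 :: "h32 \<Rightarrow> h32 \<Rightarrow> h32"
  where "r * s = H32 0 (ter r * ter s)"

instance
  by standard
    (auto simp: zero_h32_def plus_h32_def uminus_h32_def minus_h32_def times_h32_def
      algebra_simps)

end

definition scale_a :: "2 \<Rightarrow> h32" where "scale_a x = H32 x 0"
definition scale_b :: "3 \<Rightarrow> h32" where "scale_b y = H32 0 y"

definition gen_a :: h32 where "gen_a = scale_a 1"
definition gen_b :: h32 where "gen_b = scale_b 1"

lemmas h32_defs = zero_h32_def plus_h32_def uminus_h32_def minus_h32_def times_h32_def
  scale_a_def scale_b_def gen_a_def gen_b_def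

lemma h32_relations:
  "gen_a + gen_a = 0" "gen_b + gen_b + gen_b = 0"
  "gen_a * gen_a = 0" "gen_b * gen_b = gen_b"
  "gen_a * gen_b = 0" "gen_b * gen_a = 0"
  by (simp_all add: h32_defs)

lemma scale_a_values: "scale_a 0 = 0" "scale_a 1 = gen_a"
  by (simp_all add: h32_defs)

lemma scale_b_values: "scale_b 0 = 0" "scale_b 1 = gen_b" "scale_b 2 = gen_b + gen_b"
  by (simp_all add: h32_defs)

lemma UNIV_h32_image: "(UNIV :: h32 set) = (\<lambda>(x, y). H32 x y) ` (UNIV \<times> UNIV)"
proof -
  have "r \<in> (\<lambda>(x, y). H32 x y) ` (UNIV \<times> UNIV)" for r
    by (cases r) auto
  then show ?thesis by auto
qed

instance h32 :: finite
  by standard (simp add: UNIV_h32_image)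

lemma card_h32: "CARD(h32) = 6"
proof -
  have "inj (\<lambda>(x, y). H32 x y)" by (auto simp: inj_on_def)
  then have "CARD(h32) = CARD(2 \<times> 3)"
    unfolding UNIV_h32_image by (simp add: card_image)
  then show ?thesis by simp
qed

lemma h32_elements:
  "(UNIV :: h32 set) =
     {0, gen_a, gen_b, gen_a + gen_b, gen_b + gen_b, gen_a + (gen_b + gen_b)}" (is "_ = ?S")
proof -
  have "card ?S = 6"
    by (simp add: h32_defs)
  then have "?S = UNIV"
    by (intro card_subset_eq) (simp_all add: card_h32)
  then show ?thesis by (rule sym)
qed

lemma h32_nonunital: "\<not> (\<exists>e :: h32. \<forall>r. e * r = r)"
proof
  assume "\<exists>e :: h32. \<forall>r. e * r = r"
  then obtain e :: h32 where "\<And>r. e * r = r" by blast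
  from this[of gen_a] show False by (simp add: h32_defs)
qed

definition vscale_a :: "2 ^ 'n \<Rightarrow> h32 ^ 'n" where "vscale_a x = (\<chi> i. scale_a (x $ i))"
definition vscale_b :: "3 ^ 'n \<Rightarrow> h32 ^ 'n" where "vscale_b y = (\<chi> i. scale_b (y $ i))"
definition vbin :: "h32 ^ 'n \<Rightarrow> 2 ^ 'n" where "vbin c = (\<chi> i. bin (c $ i))"
definition vter :: "h32 ^ 'n \<Rightarrow> 3 ^ 'n" where "vter c = (\<chi> i. ter (c $ i))"

lemma h32_vec_decomp: "vscale_a x + vscale_b y = c \<longleftrightarrow> x = vbin c \<and> y = vter c"
proof -
  have "H32 u v = r \<longleftrightarrow> u = bin r \<and> v = ter r" for u v r
    by (cases r) auto
  then show ?thesis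
    by (auto simp: vec_eq_iff vscale_a_def vscale_b_def vbin_def vter_def
        plus_h32_def scale_a_def scale_b_def)
qed

text \<open>Submodules; \<open>r *s c\<close> is the coordinatewise multiple of \<open>c\<close> by the ring element \<open>r\<close>.\<close>

definition h32_code :: "(h32 ^ 'n) set \<Rightarrow> bool" where
  "h32_code C \<longleftrightarrow> 0 \<in> C \<and> (\<forall>c\<in>C. \<forall>d\<in>C. c + d \<in> C) \<and> (\<forall>c\<in>C. - c \<in> C)
     \<and> (\<forall>r. \<forall>c\<in>C. r *s c \<in> C)"

definition bin_code :: "(h32 ^ 'n) set \<Rightarrow> (2 ^ 'n) set" where
  "bin_code C = {u. vscale_a u \<in> C}"
definition ter_code :: "(h32 ^ 'n) set \<Rightarrow> (3 ^ 'n) set" where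
  "ter_code C = {v. vscale_b v \<in> C}"

lemma h32_code_decomp:
  assumes "h32_code C"
  shows "C = {vscale_a u + vscale_b v | u v. u \<in> bin_code C \<and> v \<in> ter_code C}" (is "_ = ?D")
proof
  show "?D \<subseteq> C"
    using assms by (auto simp: h32_code_def bin_code_def ter_code_def)
  show "C \<subseteq> ?D"
  proof
    fix c assume c: "c \<in> C"
    have dec: "vscale_a (vbin c) + vscale_b (vter c) = c"
      by (simp add: h32_vec_decomp)
    have "gen_b *s c = vscale_b (vter c)"
      by (simp add: vec_eq_iff vscale_b_def vter_def h32_defs)
    moreover have "gen_b *s c \<in> C" using assms c by (simp add: h32_code_def)
    ultimately have b: "vscale_b (vter c) \<in> C" by simp
    have "vscale_a (vbin c) = c + - vscale_b (vter c)"
      using dec by (simp add: eq_diff_eq)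
    moreover have "c + - vscale_b (vter c) \<in> C"
      using assms c b by (auto simp: h32_code_def simp del: add_uminus_conv_diff)
    ultimately have "vscale_a (vbin c) \<in> C" by simp
    with b dec show "c \<in> ?D" unfolding bin_code_def ter_code_def by (auto intro!: exI dest: sym)
  qed
qed

text \<open>
  A vector of length \<open>2m\<close> is indexed by \<open>'m + 'm\<close>, where \<open>m = CARD('m)\<close>, which is at least 1:
  \<open>x = (x\<^sub>1 | x\<^sub>2)\<close> has the coordinates \<open>x $ Inl i\<close> in \<open>x\<^sub>1\<close> and \<open>x $ Inr i\<close> in \<open>x\<^sub>2\<close>.
\<close>

definition ter_symplectic :: "3 ^ ('m::finite + 'm) \<Rightarrow> 3 ^ ('m + 'm) \<Rightarrow> 3" where
  "ter_symplectic x y =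
     (\<Sum>i\<in>UNIV. x $ Inl i * y $ Inr i) - (\<Sum>i\<in>UNIV. x $ Inr i * y $ Inl i)"

definition h32_symplectic :: "h32 ^ ('m::finite + 'm) \<Rightarrow> h32 ^ ('m + 'm) \<Rightarrow> h32" where
  "h32_symplectic c d = scale_b (ter_symplectic (vter c) (vter d))"

definition symplectic_dual :: "(h32 ^ ('m::finite + 'm)) set \<Rightarrow> (h32 ^ ('m + 'm)) set" where
  "symplectic_dual C = {y. \<forall>c\<in>C. h32_symplectic y c = 0}"

definition symplectic_nice :: "(h32 ^ ('m::finite + 'm)) set \<Rightarrow> bool" where
  "symplectic_nice C \<longleftrightarrow> card C * card (symplectic_dual C) = 36 ^ CARD('m)"

end

theory Submission
  imports Defs
begin

text \<open>
  Double counting: the integer-valued trace character \<open>\<tau>\<close> of the group of order 3 sums to zero along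
  every nonzero homomorphism. Summing \<open>\<tau> (p a b)\<close> over two finite groups paired by \<open>p\<close>, in either
  order, relates the sizes of the two annihilators. For an \<open>H\<^sub>3\<^sub>2\<close>-code \<open>C\<close> paired with the
  whole space by the symplectic form, the annihilators are the dual of \<open>C\<close> and, as the ternary form is
  nondegenerate, \<open>a C\<^sub>a\<close>. Hence \<open>|C| |C\<^sup>\<bottom>| = |C\<^sub>a| 36\<^sup>m\<close>.
\<close>

text \<open>This is \<open>\<omega>^k + \<omega>^(-k)\<close> for a primitive cube root of unity
  \<open>\<omega>\<close>, so character sums stay in the integers.\<close>

definition tr3 :: "3 \<Rightarrow> int" where "tr3 k = (if k = 0 then 2 else - 1)"

text \<open>For nonzero \<open>k\<close> the three arguments run through all residues modulo 3,
  giving 2 - 1 - 1.\<close>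

lemma tr3_coset_sum:
  assumes "k \<noteq> 0"
  shows "tr3 x + tr3 (x + k) + tr3 (x + k + k) = 0"
proof -
  \<comment> \<open>\<open>exhaust_3\<close> lists the residues as 1, 2, 3.\<close>
  have three: "(3 :: 3) = 0" by simp
  have "x = 0 \<or> x = 1 \<or> x = 2" "k = 1 \<or> k = 2"
    using exhaust_3[of x] exhaust_3[of k] assms three by auto
  then show ?thesis by (auto simp: tr3_def)
qed

text \<open>If \<open>f h\<close> is nonzero, translation by \<open>h\<close> permutes
  \<open>A\<close>, so shifting the argument of \<open>tr3\<close> by \<open>f h\<close> once or
  twice keeps the sum. The three equal sums add up to 0 termwise.\<close>

lemma sum_tr3_hom:
  fixes A :: "'a::ab_group_add set" and f :: "'a \<Rightarrow> 3"
  assumes plus: "\<And>x y. x \<in> A \<Longrightarrow> y \<in> A \<Longrightarrow> x + y \<in> A"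
    and uminus: "\<And>x. x \<in> A \<Longrightarrow> - x \<in> A"
    and add: "\<And>x y. x \<in> A \<Longrightarrow> y \<in> A \<Longrightarrow> f (x + y) = f x + f y"
  shows "(\<Sum>x\<in>A. tr3 (f x)) = (if \<forall>x\<in>A. f x = 0 then 2 * int (card A) else 0)"
proof (cases "\<forall>x\<in>A. f x = 0")
  case True
  then show ?thesis by (simp add: tr3_def)
next
  case False
  then obtain h where h: "h \<in> A" "f h \<noteq> 0" by blast
  have bij: "bij_betw (\<lambda>x. x + h) A A"
    by (rule bij_betw_byWitness[where f' = "\<lambda>x. x + - h"])
      (use plus[OF _ h(1)] plus[OF _ uminus[OF h(1)]] in auto)
  have shift: "(\<Sum>x\<in>A. tr3 (f x + k + f h)) = (\<Sum>x\<in>A. tr3 (f x + k))" for k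
    using sum.reindex_bij_betw[OF bij, of "\<lambda>x. tr3 (f x + k)"] h
    by (simp add: add ac_simps cong: sum.cong)
  have "(\<Sum>x\<in>A. tr3 (f x) + tr3 (f x + f h) + tr3 (f x + f h + f h)) = 0"
    using tr3_coset_sum[OF h(2)] by simp
  then have "3 * (\<Sum>x\<in>A. tr3 (f x)) = 0"
    using shift[of 0] shift[of "f h"] by (simp add: sum.distrib)
  with False show ?thesis by auto
qed

text \<open>Stated for abelian groups rather than vector spaces, because an \<open>h32\<close> code
  also contains elements of order 2.\<close>

lemma card_annihilator_pairing:
  fixes A :: "'a::ab_group_add set" and B :: "'b::ab_group_add set" and p :: "'a \<Rightarrow> 'b \<Rightarrow> 3"
  assumes "finite A" "finite B"
    and "\<And>x y. x \<in> A \<Longrightarrow> y \<in> A \<Longrightarrow> x + y \<in> A" "\<And>x. x \<in> A \<Longrightarrow> - x \<in> A"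
    and "\<And>x y. x \<in> B \<Longrightarrow> y \<in> B \<Longrightarrow> x + y \<in> B" "\<And>x. x \<in> B \<Longrightarrow> - x \<in> B"
    and "\<And>x y b. x \<in> A \<Longrightarrow> y \<in> A \<Longrightarrow> b \<in> B \<Longrightarrow> p (x + y) b = p x b + p y b"
    and "\<And>a x y. a \<in> A \<Longrightarrow> x \<in> B \<Longrightarrow> y \<in> B \<Longrightarrow> p a (x + y) = p a x + p a y"
  shows "card A * card {b\<in>B. \<forall>a\<in>A. p a b = 0} = card B * card {a\<in>A. \<forall>b\<in>B. p a b = 0}"
proof -
  have "(\<Sum>b\<in>B. \<Sum>a\<in>A. tr3 (p a b)) = (\<Sum>b\<in>B. if \<forall>a\<in>A. p a b = 0 then 2 * int (card A) else 0)"
    by (intro sum.cong refl sum_tr3_hom) (use assms in auto)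
  also have "\<dots> = 2 * int (card A * card {b\<in>B. \<forall>a\<in>A. p a b = 0})"
    by (simp add: sum.If_cases assms Int_def)
  finally have B: "(\<Sum>b\<in>B. \<Sum>a\<in>A. tr3 (p a b)) = \<dots>" .
  have "(\<Sum>a\<in>A. \<Sum>b\<in>B. tr3 (p a b)) = (\<Sum>a\<in>A. if \<forall>b\<in>B. p a b = 0 then 2 * int (card B) else 0)"
    by (intro sum.cong refl sum_tr3_hom) (use assms in auto)
  also have "\<dots> = 2 * int (card B * card {a\<in>A. \<forall>b\<in>B. p a b = 0})"
    by (simp add: sum.If_cases assms Int_def)
  finally have A: "(\<Sum>a\<in>A. \<Sum>b\<in>B. tr3 (p a b)) = \<dots>" .
  have "2 * int (card A * card {b\<in>B. \<forall>a\<in>A. p a b = 0})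
      = 2 * int (card B * card {a\<in>A. \<forall>b\<in>B. p a b = 0})"
    unfolding A[symmetric] B[symmetric] by (rule sum.swap)
  then show ?thesis by linarith
qed

lemma ter_symplectic_add_left: "ter_symplectic (x + y) z = ter_symplectic x z + ter_symplectic y z"
  and ter_symplectic_add_right: "ter_symplectic z (x + y) = ter_symplectic z x + ter_symplectic z y"
  by (simp_all add: ter_symplectic_def algebra_simps sum.distrib)

lemma ter_symplectic_nondegenerate:
  fixes y :: "3 ^ ('m::finite + 'm)"
  shows "(\<forall>x. ter_symplectic x y = 0) \<longleftrightarrow> y = 0"
proof
  assume *: "\<forall>x. ter_symplectic x y = 0"
  \<comment> \<open>Pairing with the unit vector at \<open>Inl i\<close> gives
    \<open>y $ Inr i\<close>; the one at \<open>Inr i\<close> gives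
    \<open>- y $ Inl i\<close>.\<close>
  have "y $ Inr i = 0" "y $ Inl i = 0" for i :: 'm
    using *[rule_format, of "axis (Inl i) 1"] *[rule_format, of "axis (Inr i) 1"]
    by (simp_all add: ter_symplectic_def axis_def if_distrib[where f = "\<lambda>x. x * _"] cong: if_cong)
  then have "y $ j = 0" for j by (cases j) auto
  then show "y = 0" by (simp add: vec_eq_iff)
qed (simp add: ter_symplectic_def)

lemma vter_add: "vter (c + d) = vter c + vter d"
  by (simp add: vec_eq_iff vter_def h32_defs)

lemma vter_vscale_b: "vter (vscale_b y) = y"
  by (simp add: vec_eq_iff vter_def vscale_b_def h32_defs)

lemma card_symplectic_dual:
  fixes C :: "(h32 ^ ('m::finite + 'm)) set"
  assumes "h32_code C"
  shows "card C * card (symplectic_dual C) = 36 ^ CARD('m) * card (bin_code C)"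
proof -
  let ?p = "\<lambda>c y. ter_symplectic (vter y) (vter c)"
  have dual: "symplectic_dual C = {y \<in> UNIV. \<forall>c\<in>C. ?p c y = 0}"
    by (auto simp: symplectic_dual_def h32_symplectic_def h32_defs)
  \<comment> \<open>\<open>vter\<close> is onto, so the whole space tests against every ternary
    vector.\<close>
  have "(\<forall>y\<in>UNIV. ?p c y = 0) \<longleftrightarrow> (\<forall>x. ter_symplectic x (vter c) = 0)" for c
    by (metis UNIV_I vter_vscale_b)
  then have radical: "(\<forall>y\<in>UNIV. ?p c y = 0) \<longleftrightarrow> vter c = 0" for c
    by (simp add: ter_symplectic_nondegenerate)
  have image: "{c\<in>C. vter c = 0} = vscale_a ` bin_code C"
  proof -
    have "c = vscale_a (vbin c)" if "vter c = 0" for c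
    proof -
      have "vscale_a (vbin c) + vscale_b (vter c) = c" by (simp add: h32_vec_decomp)
      moreover have "vscale_b (vter c) = 0"
        using that by (simp add: vec_eq_iff vscale_b_def h32_defs)
      ultimately show ?thesis by simp
    qed
    moreover have "vter (vscale_a u) = 0" for u
      by (simp add: vec_eq_iff vter_def vscale_a_def h32_defs)
    ultimately show ?thesis by (force simp: bin_code_def)
  qed
  have inj: "inj vscale_a"
    by (auto simp: inj_def vec_eq_iff vscale_a_def h32_defs)
  have "card C * card {y \<in> UNIV. \<forall>c\<in>C. ?p c y = 0}
      = card (UNIV :: (h32 ^ ('m + 'm)) set) * card {c\<in>C. \<forall>y\<in>UNIV. ?p c y = 0}"
    by (rule card_annihilator_pairing)
      (use assms in \<open>auto simp: h32_code_def vter_add ter_symplectic_add_left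
        ter_symplectic_add_right\<close>)
  \<comment> \<open>The whole space has 6^(2m) = 36^m elements.\<close>
  also have "\<dots> = 36 ^ CARD('m) * card (bin_code C)"
    unfolding radical image using card_image[OF inj_on_subset[OF inj], of "bin_code C"]
    by (simp add: card_h32 power_add flip: power_mult_distrib)
  finally show ?thesis unfolding dual .
qed

theorem corollary4p4:
  fixes C :: "(h32 ^ ('m::finite + 'm)) set"
  assumes "h32_code C"
  shows "symplectic_nice C \<longleftrightarrow> bin_code C = {0}"
proof -
  have "vscale_a 0 = (0 :: h32 ^ ('m + 'm))"
    by (simp add: vec_eq_iff vscale_a_def h32_defs)
  then have "0 \<in> bin_code C"
    using assms by (simp add: bin_code_def h32_code_def)
  \<comment> \<open>Cancelling 36^m in the counting identity turns niceness into
    \<open>card (bin_code C) = 1\<close>; as 0 lies in the set, it is then the only element.\<close>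
  then have "card (bin_code C) = 1 \<longleftrightarrow> bin_code C = {0}"
    by (auto simp: card_1_singleton_iff)
  then show ?thesis
    by (simp add: symplectic_nice_def card_symplectic_dual[OF assms])
qed

end
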